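(* For every $r, s \geq 1$ there exists a $((r-1)^{2^{s-1}}, s)$-formation that avoids every binary $(r, s)$-formation.
   Context: A sequence $s$ contains a sequence $u$ if some subsequence of $s$ can be changed into $u$ by a one-to-one renaming of its letters; otherwise it avoids $u$. An $(r,s)$-formation is a concatenation of $s$ permutations of the same set of $r$ distinct letters. An $(r,s)$-formation $f$ is binary if there is a permutation $p$ of its $r$ letters such that every permutation in $f$ is either $p$ or the reverse of $p$. *)

theory Defs
  imports Main "HOL-Library.Sublist" "HOL-Combinatorics.Multiset_Permutations"
begin

definition contains :: "'a list \<Rightarrow> 'b list \<Rightarrow> bool" where
  "contains s u \<longleftrightarrow> (\<exists>t g. subseq t s \<and> inj_on g (set t) \<and> map g t = u)"

abbreviation avoids :: "'a list \<Rightarrow> 'b list \<Rightarrow> bool" where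
  "avoids s u \<equiv> \<not> contains s u"

text \<open>A formation is a plain sequence (the concatenation); the list of its constituent
  permutations is kept separate so that binary formations can refer to it.\<close>

definition formation_blocks :: "nat \<Rightarrow> nat \<Rightarrow> 'a set \<Rightarrow> 'a list list \<Rightarrow> bool" where
  "formation_blocks r s A ps \<longleftrightarrow>
     finite A \<and> card A = r \<and> length ps = s \<and> set ps \<subseteq> permutations_of_set A"

definition formation :: "nat \<Rightarrow> nat \<Rightarrow> 'a list \<Rightarrow> bool" where
  "formation r s f \<longleftrightarrow> (\<exists>A ps. formation_blocks r s A ps \<and> f = concat ps)"

definition binary_formation :: "nat \<Rightarrow> nat \<Rightarrow> 'a list \<Rightarrow> bool" where
  "binary_formation r s f \<longleftrightarrow>
     (\<exists>A ps. formation_blocks r s A ps \<and> f = concat ps \<and>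
       (\<exists>p \<in> permutations_of_set A. \<forall>q \<in> set ps. q = p \<or> q = rev p))"

end

theory Submission
  imports Defs "HOL-Library.Nat_Bijection"
begin

text \<open>
  Squaring the alphabet realises the Erdos--Szekeres lower bound. Given \<open>s\<close> permutations \<open>p\<^sub>i\<close>
  of \<open>A\<close>, take the lexicographic squares \<open>p\<^sub>i \<times> p\<^sub>i\<close> on \<open>A \<times> A\<close> together with one further
  permutation \<open>p\<^sub>1 \<times> rev p\<^sub>1\<close>. Two pairs occur in the same order in \<open>p\<^sub>1 \<times> p\<^sub>1\<close> and
  \<open>p\<^sub>1 \<times> rev p\<^sub>1\<close> iff their first components differ. Hence a sequence of pairs which every
  new permutation contains forwards or backwards has either distinct first components or constant
  first component, and projects to such a sequence of the same length for the \<open>p\<^sub>i\<close>. Finally, in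
  a formation each letter occurs once per block, so a contained \<open>s\<close>-block formation must use all
  occurrences of its letters and is therefore contained block by block.
\<close>

section \<open>Subsequences and the order of pairs\<close>

lemma set_subset_if_subseq: "subseq q p \<Longrightarrow> set q \<subseteq> set p"
  by (induction rule: list_emb.induct) auto

lemma subseq_pair_antisym:
  assumes "distinct p" "subseq [x, y] p"
  shows "\<not> subseq [y, x] p"
  using assms by (induction p) (auto simp: subseq_singleton_left split: if_splits dest: subseq_Cons')

text \<open>In a duplicate-free list, containment can be tested on pairs. If the head
  \<open>a\<close> of \<open>p\<close> occurs in \<open>q\<close>, then nothing precedes
  \<open>a\<close> in \<open>p\<close>, so it stands first and only once in \<open>q\<close>, and
  the rest embeds in the tail.\<close>

lemma subseq_if_sorted_wrt_pairs:
  assumes "set q \<subseteq> set p" "distinct p" "sorted_wrt (\<lambda>x y. subseq [x, y] p) q"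
  shows "subseq q p"
  using assms
proof (induction p arbitrary: q)
  case Nil
  then show ?case by simp
next
  case (Cons a p)
  have tail: "subseq q' p" if q': "set q' \<subseteq> set p" "sorted_wrt (\<lambda>x y. subseq [x, y] (a # p)) q'" for q'
  proof (rule Cons.IH)
    have "subseq [x, y] p" if "x \<in> set q'" "y \<in> set q'" "subseq [x, y] (a # p)" for x y
      using that q'(1) Cons.prems(2) by (auto split: if_splits)
    then show "sorted_wrt (\<lambda>x y. subseq [x, y] p) q'"
      by (intro sorted_wrt_mono_rel[OF _ q'(2)]) blast
  qed (use q' Cons.prems in auto)
  show ?case
  proof (cases "a \<in> set q")
    case False
    then show ?thesis using tail[of q] Cons.prems by auto
  next
    case True
    then obtain u v where q: "q = u @ a # v" by (meson split_list)
    have no: "\<not> subseq [x, a] (a # p)" for x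
      using Cons.prems(2) by (auto simp: subseq_singleton_left split: if_splits dest: subseq_Cons')
    have "u = []" using Cons.prems(3) no unfolding q
      by (cases u) (auto simp: sorted_wrt_append simp del: subseq_Cons2_iff)
    moreover have "a \<notin> set v"
      using Cons.prems(3) no unfolding q by (auto simp: sorted_wrt_append simp del: subseq_Cons2_iff)
    ultimately show ?thesis using tail[of v] Cons.prems q by auto
  qed
qed

lemma sorted_wrt_pairs_if_subseq: "subseq q p \<Longrightarrow> sorted_wrt (\<lambda>x y. subseq [x, y] p) q"
proof (induction q)
  case (Cons a q)
  have "subseq [a, y] p" if "y \<in> set q" for y
  proof -
    have "subseq [a, y] (a # q)" using that by (simp add: subseq_singleton_left)
    then show ?thesis using Cons.prems by (rule subseq_order.trans)
  qed
  then show ?case using Cons by (auto dest: subseq_Cons')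
qed simp

section \<open>Lexicographic products and their projections\<close>

lemma subseq_pair_product:
  assumes "subseq [b, c] (List.product p a)"
  shows "subseq [fst b, fst c] p \<or> fst b = fst c \<and> subseq [snd b, snd c] a"
  using assms
proof (induction p)
  case (Cons x p)
  from Cons.prems obtain u v where uv: "[b, c] = u @ v" "subseq u (map (Pair x) a)"
      "subseq v (List.product p a)"
    unfolding product.simps by (rule subseq_appendE)
  \<comment> \<open>The first row of the product has constant first component \<open>x\<close>; the
    pair lies after that row, straddles its end, or lies inside it.\<close>
  consider "u = []" "v = [b, c]" | "u = [b]" "v = [c]" | "u = [b, c]" "v = []"
  proof (cases u)
    case (Cons d w)
    then show thesis using uv(1) that(2,3) by (cases w) simp_all
  qed (use uv(1) that(1) in simp)
  then show ?case
  proof cases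
    case 1
    then show ?thesis using uv(3) Cons.IH by (auto dest: subseq_Cons')
  next
    case 2
    then have "fst b = x" "fst c \<in> set p"
      using uv(2,3) by (auto simp: subseq_singleton_left)
    then show ?thesis by (simp add: subseq_singleton_left)
  next
    case 3
    then have "subseq (map fst [b, c]) (map fst (map (Pair x) a))"
      "subseq (map snd [b, c]) (map snd (map (Pair x) a))"
      using uv(2) subseq_map by blast+
    moreover have "fst b = x" "fst c = x"
      using 3 set_subset_if_subseq[OF uv(2)] by auto
    ultimately show ?thesis by (simp add: comp_def)
  qed
qed simp

lemma subseq_revI: "subseq q p \<Longrightarrow> subseq (rev q) (rev p)"
  by (induction rule: list_emb.induct) (auto intro: list_emb_append_mono subseq_rev_drop_many)

lemma subseq_rev: "subseq (rev q) (rev p) \<longleftrightarrow> subseq q p"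
  using subseq_revI[of q p] subseq_revI[of "rev q" "rev p"] by auto

lemma subseq_rev_swap: "subseq [x, y] (rev p) \<longleftrightarrow> subseq [y, x] p"
  using subseq_rev[of "[y, x]" p] by simp

text \<open>Distinct first components exclude the second alternative of
  \<open>subseq_pair_product\<close>, so all pairs of \<open>q\<close> keep their order under
  \<open>fst\<close>.\<close>

lemma subseq_map_fst_product:
  assumes "subseq q (List.product p a)" "distinct p" "distinct (map fst q)"
  shows "subseq (map fst q) p"
proof (rule subseq_if_sorted_wrt_pairs)
  show "set (map fst q) \<subseteq> set p"
    using set_subset_if_subseq[OF assms(1)] by fastforce
  have "sorted_wrt (\<lambda>b c. fst b \<noteq> fst c) q"
    using assms(3) by (simp add: distinct_conv_nth sorted_wrt_iff_nth_less)
  with sorted_wrt_pairs_if_subseq[OF assms(1)]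
  have "sorted_wrt (\<lambda>b c. subseq [fst b, fst c] p) q"
    unfolding sorted_wrt_iff_nth_less by (meson subseq_pair_product)
  then show "sorted_wrt (\<lambda>x y. subseq [x, y] p) (map fst q)"
    by (simp add: sorted_wrt_map)
qed (fact assms(2))

lemma subseq_map_snd_product:
  assumes "subseq q (List.product p a)" "distinct p" "distinct a"
    and "\<And>b c. b \<in> set q \<Longrightarrow> c \<in> set q \<Longrightarrow> fst b = fst c"
  shows "subseq (map snd q) a"
proof (rule subseq_if_sorted_wrt_pairs)
  show "set (map snd q) \<subseteq> set a"
    using set_subset_if_subseq[OF assms(1)] by fastforce
  \<comment> \<open>Equal first components thus rule out the first alternative of
    \<open>subseq_pair_product\<close>.\<close>
  have "\<not> subseq [x, x] p" for x
    using subseq_pair_antisym[OF assms(2), of x x] by blast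
  then have "subseq [snd b, snd c] a"
    if "b \<in> set q" "c \<in> set q" "subseq [b, c] (List.product p a)" for b c
    using subseq_pair_product[OF that(3)] assms(4)[OF that(1,2)] by metis
  from this sorted_wrt_pairs_if_subseq[OF assms(1)]
  have "sorted_wrt (\<lambda>b c. subseq [snd b, snd c] a) q"
    by (rule sorted_wrt_mono_rel)
  then show "sorted_wrt (\<lambda>x y. subseq [x, y] a) (map snd q)"
    by (simp add: sorted_wrt_map)
qed (fact assms(3))

text \<open>Two entries with equal first components would have their second components in the same
  order in both \<open>p\<close> and \<open>rev p\<close>.\<close>

lemma distinct_map_fst_if_same_way:
  assumes "distinct p" "subseq q (List.product p p)" "subseq q (List.product p (rev p))"
  shows "distinct (map fst q)"
proof -
  have "fst (q ! i) \<noteq> fst (q ! j)" if "i < j" "j < length q" for i j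
  proof -
    let ?b = "q ! i" and ?c = "q ! j"
    have "subseq [?b, ?c] (List.product p p)" "subseq [?b, ?c] (List.product p (rev p))"
      using that sorted_wrt_pairs_if_subseq[OF assms(2)] sorted_wrt_pairs_if_subseq[OF assms(3)]
      by (simp_all add: sorted_wrt_iff_nth_less)
    then show ?thesis
      using subseq_pair_antisym[OF assms(1)] by (metis subseq_pair_product subseq_rev_swap)
  qed
  then show ?thesis
    unfolding distinct_conv_nth by (metis length_map linorder_neqE_nat nth_map)
qed

text \<open>Both products order different first components as \<open>p\<close> does, so these would
  occur in both orders in \<open>p\<close>.\<close>

lemma fst_eq_if_opposite_way:
  assumes "distinct p" "subseq q (List.product p p)" "subseq (rev q) (List.product p (rev p))"
    and "b \<in> set q" "c \<in> set q"
  shows "fst b = fst c"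
proof -
  have "fst (q ! i) = fst (q ! j)" if "i < j" "j < length q" for i j
  proof -
    let ?b = "q ! i" and ?c = "q ! j"
    have "subseq q (rev (List.product p (rev p)))"
      using subseq_rev[of "rev q" "List.product p (rev p)"] assms(3) by simp
    then have "subseq [?b, ?c] (List.product p p)" "subseq [?b, ?c] (rev (List.product p (rev p)))"
      using that sorted_wrt_pairs_if_subseq[OF assms(2)] sorted_wrt_pairs_if_subseq[of q]
      by (simp_all add: sorted_wrt_iff_nth_less)
    then show ?thesis
      using subseq_pair_antisym[OF assms(1)]
      by (metis subseq_pair_product subseq_rev_swap)
  qed
  then show ?thesis
    using assms(4,5) unfolding in_set_conv_nth by (metis linorder_neqE_nat)
qed

section \<open>Families of permutations without a common monotone sequence\<close>

text \<open>The Erdos--Szekeres property for several orders at once. As \<open>q\<close> ranges over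
  all lists, projections and preimages of a sequence qualify without any membership
  condition.\<close>

definition no_common_monotone :: "nat \<Rightarrow> 'a list list \<Rightarrow> bool" where
  "no_common_monotone r ps \<longleftrightarrow>
     (\<forall>q. length q = r \<longrightarrow> (\<exists>p \<in> set ps. \<not> subseq q p \<and> \<not> subseq (rev q) p))"

lemma no_common_monotone_square:
  assumes "no_common_monotone r ps" "p0 \<in> set ps" "\<And>p. p \<in> set ps \<Longrightarrow> distinct p"
  shows "no_common_monotone r (List.product p0 (rev p0) # map (\<lambda>p. List.product p p) ps)"
  unfolding no_common_monotone_def
proof (intro allI impI, rule ccontr)
  fix q :: "('a \<times> 'a) list"
  assume len: "length q = r"
    and "\<not> (\<exists>p \<in> set (List.product p0 (rev p0) # map (\<lambda>p. List.product p p) ps).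
               \<not> subseq q p \<and> \<not> subseq (rev q) p)"
  then have last: "subseq q (List.product p0 (rev p0)) \<or> subseq (rev q) (List.product p0 (rev p0))"
    and squares: "\<And>p. p \<in> set ps \<Longrightarrow> subseq q (List.product p p) \<or> subseq (rev q) (List.product p p)"
    by auto
  have d0: "distinct p0" using assms(2,3) by blast
  consider "distinct (map fst q)" | "\<And>b c. b \<in> set q \<Longrightarrow> c \<in> set q \<Longrightarrow> fst b = fst c"
  proof -
    \<comment> \<open>Cases 1 and 2 have the same direction in both products, cases 3 and 4 opposite
      ones; 2 and 4 reduce to \<open>rev q\<close>.\<close>
    from last squares[OF assms(2)] consider
      "subseq q (List.product p0 (rev p0))" "subseq q (List.product p0 p0)"
      | "subseq (rev q) (List.product p0 (rev p0))" "subseq (rev q) (List.product p0 p0)"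
      | "subseq (rev q) (List.product p0 (rev p0))" "subseq q (List.product p0 p0)"
      | "subseq q (List.product p0 (rev p0))" "subseq (rev q) (List.product p0 p0)"
      by blast
    then show thesis
    proof cases
      case 1
      then show thesis using distinct_map_fst_if_same_way[OF d0, of q] that(1) by blast
    next
      case 2
      then show thesis
        using distinct_map_fst_if_same_way[OF d0, of "rev q"] that(1)
        by (metis distinct_rev rev_map)
    next
      case 3
      then show thesis using fst_eq_if_opposite_way[OF d0, of q] that(2) by blast
    next
      case 4
      then show thesis
        by (intro that(2) fst_eq_if_opposite_way[OF d0, of "rev q"]) auto
    qed
  qed
  then show False
  proof cases
    case 1
    \<comment> \<open>The projection still has length \<open>r\<close>, so some \<open>p\<close>
      contains it in neither direction, although \<open>List.product p p\<close> contains
      \<open>q\<close> in one.\<close>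
    obtain p where p: "p \<in> set ps" "\<not> subseq (map fst q) p" "\<not> subseq (rev (map fst q)) p"
      using assms(1) len unfolding no_common_monotone_def by (metis length_map)
    show False
      using squares[OF p(1)] subseq_map_fst_product[of q p p] subseq_map_fst_product[of "rev q" p p]
        p assms(3)[OF p(1)] 1 by (metis distinct_rev rev_map)
  next
    case 2
    obtain p where p: "p \<in> set ps" "\<not> subseq (map snd q) p" "\<not> subseq (rev (map snd q)) p"
      using assms(1) len unfolding no_common_monotone_def by (metis length_map)
    show False
      using squares[OF p(1)] subseq_map_snd_product[of q p p] subseq_map_snd_product[of "rev q" p p]
        p assms(3)[OF p(1)] 2 by (metis set_rev rev_map)
  qed
qed

lemma no_common_monotone_map:
  assumes "no_common_monotone r ps" "inj f"
  shows "no_common_monotone r (map (map f) ps)"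
  unfolding no_common_monotone_def
proof (intro allI impI, rule ccontr)
  fix q
  assume len: "length q = r"
    and "\<not> (\<exists>p \<in> set (map (map f) ps). \<not> subseq q p \<and> \<not> subseq (rev q) p)"
  then have all: "subseq q (map f p) \<or> subseq (rev q) (map f p)" if "p \<in> set ps" for p
    using that by auto
  \<comment> \<open>\<open>inv f\<close> undoes the renaming and pulls a common sequence back with
    its length.\<close>
  have "subseq (map (inv f) q) p \<or> subseq (rev (map (inv f) q)) p" if "p \<in> set ps" for p
    using all[OF that] subseq_map[of q "map f p" "inv f"] subseq_map[of "rev q" "map f p" "inv f"]
      assms(2) by (auto simp: rev_map comp_def)
  then show False
    using assms(1) len unfolding no_common_monotone_def by (metis length_map)
qed

lemma ex_no_common_monotone_blocks:
  assumes "r \<ge> 1"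
  shows "\<exists>(A :: nat set) ps. formation_blocks ((r - 1) ^ (2 ^ n)) (Suc n) A ps \<and> no_common_monotone r ps"
proof (induction n)
  case 0
  \<comment> \<open>A single word of \<open>r - 1\<close> letters is too short for any
    \<open>q\<close>; \<open>r \<ge> 1\<close> keeps the subtraction exact.\<close>
  have "formation_blocks (r - 1) 1 {..<r - 1} [[0..<r - 1]]"
    by (auto simp: formation_blocks_def permutations_of_set_def)
  moreover have "no_common_monotone r [[0..<r - 1]]"
    using assms by (auto simp: no_common_monotone_def)
  ultimately show ?case by auto
next
  case (Suc n)
  then obtain A :: "nat set" and ps
    where ps: "finite A" "card A = (r - 1) ^ 2 ^ n" "length ps = Suc n"
      "\<And>p. p \<in> set ps \<Longrightarrow> set p = A \<and> distinct p" "no_common_monotone r ps"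
    by (auto simp: formation_blocks_def permutations_of_set_def)
  \<comment> \<open>\<open>prod_encode\<close> turns pairs back into natural numbers, so the
    induction stays within one type.\<close>
  define B where "B = prod_encode ` (A \<times> A)"
  define p0 where "p0 = hd ps"
  define ps' where "ps' = map (map prod_encode)
    (List.product p0 (rev p0) # map (\<lambda>p. List.product p p) ps)"
  have p0: "p0 \<in> set ps" using ps(3) by (cases ps) (auto simp: p0_def)
  have "card B = (r - 1) ^ 2 ^ Suc n"
    using ps(2) by (simp add: B_def card_image inj_prod_encode card_cartesian_product power_mult
        power2_eq_square power_mult_distrib)
  moreover have "set p = B \<and> distinct p" if "p \<in> set ps'" for p
    using that ps(4) p0 by (auto simp: ps'_def B_def distinct_map inj_prod_encode distinct_product)
  ultimately have "formation_blocks ((r - 1) ^ 2 ^ Suc n) (Suc (Suc n)) B ps'"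
    using ps(1,3)
    by (auto simp: formation_blocks_def permutations_of_set_def) (simp_all add: ps'_def B_def)
  moreover have "no_common_monotone r ps'"
    unfolding ps'_def using ps(4,5) p0
    by (intro no_common_monotone_map no_common_monotone_square inj_prod_encode) auto
  ultimately show ?case by blast
qed

section \<open>Containment of formations, block by block\<close>

lemma filter_blocks_eq_if_subseq_concat:
  assumes "subseq (concat ts) (concat ps)" "length ts = length ps"
    and "\<And>t. t \<in> set ts \<Longrightarrow> distinct t \<and> set t = B"
    and "\<And>p. p \<in> set ps \<Longrightarrow> distinct p \<and> B \<subseteq> set p"
  shows "ts = map (filter (\<lambda>x. x \<in> B)) ps"
proof -
  let ?F = "filter (\<lambda>x. x \<in> B)"
  have len_t: "length t = card B" if "t \<in> set ts" for t
    using assms(3)[OF that] distinct_card by force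
  have len_p: "length (?F p) = card B" if "p \<in> set ps" for p
  proof -
    have "set (?F p) = B" "distinct (?F p)" using assms(4)[OF that] by auto
    then show ?thesis using distinct_card by metis
  qed
  have "?F (concat ts) = concat ts" using assms(3) by (auto simp: filter_id_conv)
  then have "subseq (concat ts) (concat (map ?F ps))"
    using subseq_filter[OF assms(1), of "\<lambda>x. x \<in> B"] by (simp add: filter_concat)
  \<comment> \<open>Both sides have \<open>card B\<close> letters per block. A subsequence of full
    length is the whole list, and equal block lengths let both concatenations be cut at the same
    places.\<close>
  moreover have "length (concat ts) = length (concat (map ?F ps))"
  proof -
    have "map length ts = map (length \<circ> ?F) ps"
      using len_t len_p assms(2) by (intro nth_equalityI) auto
    then show ?thesis by (simp add: length_concat)
  qed
  ultimately have "concat ts = concat (map ?F ps)" by (rule subseq_same_length)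
  then show ?thesis
    using assms(2) len_t len_p
    by (intro concat_injective) (auto dest!: set_zip_leftD set_zip_rightD simp: set_zip)
qed

text \<open>A copy of \<open>u\<close> would restrict each block of \<open>ps\<close> to one fixed
  word or its reverse, giving a common sequence of length \<open>r\<close>.\<close>

lemma avoids_binary_formation:
  assumes ps: "formation_blocks N s A ps" "no_common_monotone r ps" and "s \<ge> 1"
    and u: "binary_formation r s u"
  shows "avoids (concat ps) u"
proof
  assume "contains (concat ps) u"
  then obtain t g where t: "subseq t (concat ps)" "inj_on g (set t)" "map g t = u"
    unfolding contains_def by blast
  from u obtain C qs q where qs: "card C = r" "length qs = s" "u = concat qs"
    "\<And>p. p \<in> set qs \<Longrightarrow> set p = C \<and> distinct p" "set q = C" "distinct q"
    "\<And>p. p \<in> set qs \<Longrightarrow> p = q \<or> p = rev q"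
    unfolding binary_formation_def formation_blocks_def permutations_of_set_def by blast
  \<comment> \<open>\<open>h\<close> inverts the renaming \<open>g\<close>, so it turns the blocks
    of \<open>u\<close> into those of the copy \<open>t\<close>.\<close>
  define h where "h = inv_into (set t) g"
  define B where "B = h ` C"
  have t_eq: "t = concat (map (map h) qs)"
  proof -
    have "t = map h u"
      unfolding t(3)[symmetric] using t(2) by (auto simp: h_def intro!: map_idI[symmetric])
    then show ?thesis by (simp add: qs(3) map_concat)
  qed
  have "C = g ` set t"
  proof -
    \<comment> \<open>By \<open>s \<ge> 1\<close> there is a block, and it shows every letter of
      \<open>C\<close>.\<close>
    have "set u = C" using qs(2,3,4) \<open>s \<ge> 1\<close> by (cases qs) auto
    then show ?thesis using t(3) by auto
  qed
  then have h: "inj_on h C" by (simp add: h_def inj_on_inv_into)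
  have "B = set t" using \<open>C = g ` set t\<close> t(2) by (auto simp: B_def h_def)
  have "B \<subseteq> A"
    using set_subset_if_subseq[OF t(1)] ps(1) \<open>B = set t\<close>
    by (fastforce simp: formation_blocks_def permutations_of_set_def)
  then have filt: "map (map h) qs = map (filter (\<lambda>x. x \<in> B)) ps"
    using t(1) t_eq ps(1) qs(2,4) h
    by (intro filter_blocks_eq_if_subseq_concat)
      (auto simp: formation_blocks_def permutations_of_set_def B_def distinct_map)
  have "subseq (map h q) p \<or> subseq (rev (map h q)) p" if "p \<in> set ps" for p
  proof -
    have "filter (\<lambda>x. x \<in> B) p \<in> set (map (map h) qs)" unfolding filt using that by simp
    then have "filter (\<lambda>x. x \<in> B) p = map h q \<or> filter (\<lambda>x. x \<in> B) p = rev (map h q)"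
      using qs(7) by (auto simp: rev_map)
    then show ?thesis by (metis subseq_filter_left)
  qed
  moreover have "length (map h q) = r" using qs(1,5,6) distinct_card by force
  ultimately show False using ps(2) unfolding no_common_monotone_def by blast
qed

theorem theorem2p5:
  fixes r s :: nat
  assumes "r \<ge> 1" and "s \<ge> 1"
  shows "\<exists>f :: nat list. formation ((r - 1) ^ (2 ^ (s - 1))) s f \<and>
           (\<forall>u :: nat list. binary_formation r s u \<longrightarrow> avoids f u)"
proof -
  \<comment> \<open>Starting from one block, \<open>s - 1\<close> squarings give \<open>s\<close>
    blocks.\<close>
  obtain A :: "nat set" and ps where ps: "formation_blocks ((r - 1) ^ (2 ^ (s - 1))) s A ps"
    "no_common_monotone r ps"
    using ex_no_common_monotone_blocks[OF assms(1), of "s - 1"] assms(2) by auto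
  have "formation ((r - 1) ^ (2 ^ (s - 1))) s (concat ps)"
    using ps(1) unfolding formation_def by blast
  then show ?thesis
    using avoids_binary_formation[OF ps assms(2)] by blast
qed

end
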